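(* Let $\mathbf{A}_1,\ldots,\mathbf{A}_n$ be $d\times d$ positive semidefinite matrices that commute pairwise, and let $1\le k\le n$. Then $$\left\| \mathbb{E}_{\mathrm{wo}}\left[ \prod_{j=1}^k \mathbf{A}_{i_j} \right]\right\|\leq \left\| \mathbb{E}_{\mathrm{wr}}\left[ \prod_{j=1}^k \mathbf{A}_{i_j} \right]\right\|$$ and $$\left\| \mathbb{E}_{\mathrm{wo}}\left[ \prod_{j=1}^k \mathbf{A}_{i_{k-j+1}}\prod_{j=1}^k \mathbf{A}_{i_j}\right] \right\| \leq \left\| \mathbb{E}_{\mathrm{wr}}\left[ \prod_{j=1}^k \mathbf{A}_{i_{k-j+1}}\prod_{j=1}^k \mathbf{A}_{i_j}\right] \right\| .$$
   Context: Matrices are real and positive semidefinite matrices are symmetric; $\|\cdot\|$ is the operator (spectral) norm. For a function $f$ of $k$ matrix arguments and a tuple $(\mathbf{A}_1,\dots,\mathbf{A}_n)$ with $k\le n$, the without-replacement expectation is $$\mathbb{E}_{\mathrm{wo}}[f(\mathbf{A}_{i_1},\ldots,\mathbf{A}_{i_k})]=\frac{(n-k)!}{n!}\sum_{j_1,\dots,j_k \text{ pairwise distinct in }\{1,\dots,n\}} f(\mathbf{A}_{j_1},\ldots,\mathbf{A}_{j_k}),$$ and the with-replacement expectation is $$\mathbb{E}_{\mathrm{wr}}[f(\mathbf{A}_{i_1},\ldots,\mathbf{A}_{i_k})]=n^{-k}\sum_{(j_1,\ldots,j_k)\in\{1,\dots,n\}^k} f(\mathbf{A}_{j_1},\ldots,\mathbf{A}_{j_k}).$$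 Product convention: $\prod_{j=1}^k \mathbf{M}_j$ means $\mathbf{M}_k\mathbf{M}_{k-1}\cdots\mathbf{M}_1$. *)

theory Defs
  imports "HOL-Analysis.Analysis"
begin

definition psd :: "real ^ 'd ^ 'd \<Rightarrow> bool" where
  "psd M \<longleftrightarrow> transpose M = M \<and> (\<forall>x. 0 \<le> x \<bullet> (M *v x))"

(* The class norm on real ^ 'd ^ 'd is the Frobenius norm, hence the separate definition. *)
definition opnorm :: "real ^ 'd ^ 'd \<Rightarrow> real" where
  "opnorm M = onorm (\<lambda>x. M *v x)"

(* mprod k M = M k ** ... ** M 2 ** M 1: factors with larger index stand on the left. *)
primrec mprod :: "nat \<Rightarrow> (nat \<Rightarrow> real ^ 'd ^ 'd) \<Rightarrow> real ^ 'd ^ 'd" where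
  "mprod 0 M = mat 1"
| "mprod (Suc k) M = M (Suc k) ** mprod k M"

(* A k-tuple is a function on {1..k}, undefined elsewhere; f takes such a tuple. *)
definition expect_wo ::
  "nat \<Rightarrow> nat \<Rightarrow> (nat \<Rightarrow> 'a) \<Rightarrow> ((nat \<Rightarrow> 'a) \<Rightarrow> 'b::real_vector) \<Rightarrow> 'b" where
  "expect_wo n k A f = (fact (n - k) / fact n) *\<^sub>R
     (\<Sum>j \<in> {j \<in> {1..k} \<rightarrow>\<^sub>E {1..n}. inj_on j {1..k}}. f (\<lambda>l\<in>{1..k}. A (j l)))"

definition expect_wr ::
  "nat \<Rightarrow> nat \<Rightarrow> (nat \<Rightarrow> 'a) \<Rightarrow> ((nat \<Rightarrow> 'a) \<Rightarrow> 'b::real_vector) \<Rightarrow> 'b" where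
  "expect_wr n k A f = (1 / real n ^ k) *\<^sub>R
     (\<Sum>j \<in> {1..k} \<rightarrow>\<^sub>E {1..n}. f (\<lambda>l\<in>{1..k}. A (j l)))"

end

(* The norm of the without-replacement expectation W is attained at a common eigenvector v of all
   the A i, found in the top eigenspace of W^T W. On v both expectations act as the scalars obtained
   by replacing A i with its eigenvalue a i >= 0 (or with its square, for the two-sided product), so
   the claim reduces to Maclaurin's inequality e_k / (n choose k) <= (e_1 / n)^k. That follows by
   induction on k from Chebyshev's sum inequality: (k + 1) e_{k+1} is the sum of a i times e_k of the
   remaining variables, and the latter decreases as a i increases. *)
theory Submission
  imports Defs
begin

section \<open>Maclaurin's inequality\<close>

text \<open>The \<open>k\<close>-th elementary symmetric polynomial in the values
  \<open>a i\<close>, indexed by sets so that dropping a variable is just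
  \<open>I - {i}\<close>.\<close>

definition esym :: "('i \<Rightarrow> real) \<Rightarrow> 'i set \<Rightarrow> nat \<Rightarrow> real" where
  "esym a I k = (\<Sum>S \<in> {S. S \<subseteq> I \<and> card S = k}. prod a S)"

lemma esym_nonneg:
  assumes "\<And>i. i \<in> I \<Longrightarrow> 0 \<le> a i"
  shows "0 \<le> esym a I k"
  unfolding esym_def using assms by (intro sum_nonneg prod_nonneg) auto

lemma esym_0:
  assumes "finite I"
  shows "esym a I 0 = 1"
proof -
  have "{S. S \<subseteq> I \<and> card S = 0} = {{}}"
    using assms by (auto dest: finite_subset)
  then show ?thesis by (simp add: esym_def)
qed

text \<open>A subset of size \<open>Suc k\<close> either avoids \<open>x\<close> or arises from
  exactly one \<open>k\<close>-subset of \<open>J\<close> by inserting \<open>x\<close>.\<close>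

lemma esym_insert_Suc:
  assumes "finite J" "x \<notin> J"
  shows "esym a (insert x J) (Suc k) = esym a J (Suc k) + a x * esym a J k"
proof -
  let ?P = "\<lambda>k. {S. S \<subseteq> J \<and> card S = k}"
  have fin: "finite (?P k)" for k
    using assms(1) by (auto intro: finite_subset[of _ "Pow J"])
  have *: "finite S \<and> x \<notin> S" if "S \<subseteq> J" for S
    using that assms by (auto dest: finite_subset)
  have split: "{S. S \<subseteq> insert x J \<and> card S = Suc k} = ?P (Suc k) \<union> insert x ` ?P k"
  proof (intro equalityI subsetI)
    fix S assume S: "S \<in> {S. S \<subseteq> insert x J \<and> card S = Suc k}"
    show "S \<in> ?P (Suc k) \<union> insert x ` ?P k"
    proof (cases "x \<in> S")
      case True
      then have "S = insert x (S - {x})" "S - {x} \<subseteq> J" "card (S - {x}) = k"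
        using S by auto
      then show ?thesis by blast
    qed (use S in auto)
  qed (use * in auto)
  have inj: "inj_on (insert x) (?P k)"
    using assms(2) by (auto simp: inj_on_def)
  have disj: "?P (Suc k) \<inter> insert x ` ?P k = {}"
    using assms(2) by auto
  have "esym a (insert x J) (Suc k) = esym a J (Suc k) + (\<Sum>S\<in>?P k. prod a (insert x S))"
    unfolding esym_def split
    by (subst sum.union_disjoint) (use fin disj inj in \<open>auto simp: sum.reindex\<close>)
  also have "(\<Sum>S\<in>?P k. prod a (insert x S)) = a x * esym a J k"
    unfolding esym_def sum_distrib_left by (intro sum.cong) (use * in auto)
  finally show ?thesis .
qed

text \<open>Double counting: a \<open>k\<close>-subset \<open>S\<close> contributes once for each
  \<open>i\<close> outside \<open>S\<close>. The factor is a real difference, and for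
  \<open>k > card I\<close> both sides are 0.\<close>

lemma sum_esym_remove:
  assumes "finite I"
  shows "(\<Sum>i\<in>I. esym a (I - {i}) k) = (real (card I) - real k) * esym a I k"
proof -
  let ?P = "{S. S \<subseteq> I \<and> card S = k}"
  have fin: "finite ?P"
    using assms by (auto intro: finite_subset[of _ "Pow I"])
  \<comment> \<open>Rewritten as a sum over all \<open>k\<close>-subsets of \<open>I\<close> with an
    indicator, so that the index set no longer depends on \<open>i\<close> and the two sums can be
    swapped.\<close>
  have "esym a (I - {i}) k = (\<Sum>S\<in>?P. if i \<notin> S then prod a S else 0)" for i
    unfolding esym_def using fin
    by (subst sum.inter_filter[symmetric]) (auto intro!: sum.cong)
  then have "(\<Sum>i\<in>I. esym a (I - {i}) k)
      = (\<Sum>S\<in>?P. \<Sum>i\<in>I. if i \<notin> S then prod a S else 0)"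
    by (simp add: sum.swap[of _ I])
  also have "\<dots> = (\<Sum>S\<in>?P. (real (card I) - real k) * prod a S)"
  proof (intro sum.cong refl)
    fix S assume S: "S \<in> ?P"
    then have "finite S" "card S \<le> card I"
      using assms by (auto dest: finite_subset intro: card_mono)
    have "{i \<in> I. i \<notin> S} = I - S" by auto
    then show "(\<Sum>i\<in>I. if i \<notin> S then prod a S else 0) = (real (card I) - real k) * prod a S"
      using S \<open>finite S\<close> \<open>card S \<le> card I\<close> assms
      by (subst sum.inter_filter[symmetric]) (auto simp: card_Diff_subset of_nat_diff)
  qed
  finally show ?thesis by (simp add: esym_def sum_distrib_left)
qed

text \<open>The recurrence for removing \<open>i\<close> turns each term into a difference of
  symmetric polynomials of degree \<open>Suc k\<close>; summing, the previous count leaves the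
  coefficient \<open>card I - (card I - Suc k)\<close>, taken in the reals.\<close>

lemma sum_mult_esym_remove:
  assumes "finite I"
  shows "(\<Sum>i\<in>I. a i * esym a (I - {i}) k) = real (Suc k) * esym a I (Suc k)"
proof -
  have "a i * esym a (I - {i}) k = esym a I (Suc k) - esym a (I - {i}) (Suc k)" if "i \<in> I" for i
    using esym_insert_Suc[of "I - {i}" i a k] assms that by (simp add: insert_absorb)
  then have "(\<Sum>i\<in>I. a i * esym a (I - {i}) k)
      = real (card I) * esym a I (Suc k) - (\<Sum>i\<in>I. esym a (I - {i}) (Suc k))"
    by (simp add: sum_subtractf)
  then show ?thesis
    using sum_esym_remove[OF assms, of a "Suc k"] by (simp add: algebra_simps)
qed

text \<open>Summing \<open>(a i - a j) * (b i - b j)\<close> over all pairs gives twice the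
  difference of the two sides. Opposite ordering of \<open>a\<close> and \<open>b\<close> is
  expressed pairwise, so \<open>I\<close> carries no order.\<close>

lemma Chebyshev_sum_antimono:
  fixes a b :: "'i \<Rightarrow> real"
  assumes "\<And>i j. i \<in> I \<Longrightarrow> j \<in> I \<Longrightarrow> (a i - a j) * (b i - b j) \<le> 0"
  shows "real (card I) * (\<Sum>i\<in>I. a i * b i) \<le> sum a I * sum b I"
proof -
  have "(\<Sum>i\<in>I. \<Sum>j\<in>I. (a i - a j) * (b i - b j)) \<le> 0"
    using assms by (intro sum_nonpos) auto
  moreover have "(\<Sum>i\<in>I. \<Sum>j\<in>I. (a i - a j) * (b i - b j))
      = 2 * (real (card I) * (\<Sum>i\<in>I. a i * b i) - sum a I * sum b I)"
  proof -
    have "(\<Sum>i\<in>I. \<Sum>j\<in>I. (a i - a j) * (b i - b j))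
      = (\<Sum>i\<in>I. \<Sum>j\<in>I. a i * b i) + (\<Sum>i\<in>I. \<Sum>j\<in>I. a j * b j)
        - (\<Sum>i\<in>I. \<Sum>j\<in>I. a i * b j) - (\<Sum>i\<in>I. \<Sum>j\<in>I. a j * b i)"
      unfolding sum.distrib[symmetric] sum_subtractf[symmetric]
      by (intro sum.cong refl) (simp add: algebra_simps)
    moreover have "(\<Sum>i\<in>I. \<Sum>j\<in>I. a j * b i) = sum a I * sum b I"
      by (subst sum.swap) (simp add: sum_product)
    moreover have "(\<Sum>i\<in>I. \<Sum>j\<in>I. a i * b j) = sum a I * sum b I"
      by (simp add: sum_product)
    ultimately show ?thesis
      by (simp add: sum_distrib_left[symmetric])
  qed
  ultimately show ?thesis by simp
qed

text \<open>Both sets contain \<open>I - {i, j}\<close>. Expanding each over its one further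
  variable cancels the terms of degree \<open>k\<close>, and what remains is
  \<open>- (a i - a j)\<close> times a nonnegative symmetric polynomial of degree
  \<open>k - 1\<close>.\<close>

lemma esym_remove_antimono:
  assumes "finite I" "\<And>i. i \<in> I \<Longrightarrow> 0 \<le> a i" "i \<in> I" "j \<in> I"
  shows "(a i - a j) * (esym a (I - {i}) k - esym a (I - {j}) k) \<le> 0"
proof (cases "i = j \<or> k = 0")
  case True
  then show ?thesis using assms(1) by (auto simp: esym_0)
next
  case False
  then obtain l where l: "k = Suc l" by (cases k) auto
  let ?J = "I - {i, j}"
  have "insert j ?J = I - {i}" "insert i ?J = I - {j}"
    using False assms by auto
  then have "esym a (I - {i}) k - esym a (I - {j}) k = - (a i - a j) * esym a ?J l"
    using esym_insert_Suc[of ?J j a l] esym_insert_Suc[of ?J i a l] assms(1)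
    by (simp add: l algebra_simps)
  then have "(a i - a j) * (esym a (I - {i}) k - esym a (I - {j}) k)
      = - ((a i - a j)\<^sup>2 * esym a ?J l)"
    unfolding power2_eq_square by (simp only: mult_minus_left mult_minus_right mult.assoc)
  moreover have "0 \<le> esym a ?J l"
    using assms(2) by (intro esym_nonneg) auto
  ultimately show ?thesis by simp
qed

text \<open>Chebyshev's inequality for \<open>a i\<close> and \<open>esym a (I - {i}) k\<close>,
  with both sums evaluated by the counting identities. For \<open>k < card I\<close> it says that
  passing from \<open>k\<close> to \<open>Suc k\<close> multiplies the normalised symmetric mean by
  at most the arithmetic mean.\<close>

lemma esym_Suc_le:
  assumes "finite I" "\<And>i. i \<in> I \<Longrightarrow> 0 \<le> a i"
  shows "real (card I) * (real (Suc k) * esym a I (Suc k))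
    \<le> sum a I * ((real (card I) - real k) * esym a I k)"
  using Chebyshev_sum_antimono[of I a "\<lambda>i. esym a (I - {i}) k", OF esym_remove_antimono]
    sum_esym_remove[OF assms(1), of a k] sum_mult_esym_remove[OF assms(1), of a k] assms
  by simp

text \<open>The left side is \<open>esym a I k\<close> divided by the binomial coefficient, spelled
  with factorials to match the normalisation of \<open>expect_wo\<close>. Each induction step costs
  one factor of the arithmetic mean.\<close>

lemma esym_Maclaurin:
  assumes "finite I" "\<And>i. i \<in> I \<Longrightarrow> 0 \<le> a i" "k \<le> card I"
  shows "fact (card I - k) / fact (card I) * (fact k * esym a I k)
    \<le> (sum a I / real (card I)) ^ k"
  using assms(3)
proof (induction k)
  case 0
  then show ?case using assms(1) by (simp add: esym_0)
next
  case (Suc k)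
  let ?m = "card I"
  have m: "0 < ?m" "k < ?m" using Suc.prems by auto
  have s: "0 \<le> sum a I" using assms(2) by (rule sum_nonneg)
  \<comment> \<open>Absorbs the factor \<open>card I - k\<close> from \<open>esym_Suc_le\<close>
    into the factorial, which restores the normalisation for \<open>k\<close>.\<close>
  have f: "(fact (?m - k) :: real) = (real ?m - real k) * fact (?m - Suc k)"
    using m fact_reduce[of "?m - k", where 'a = real] by (simp add: of_nat_diff)
  have "real (Suc k) * esym a I (Suc k)
      \<le> sum a I / ?m * ((real ?m - real k) * esym a I k)"
    using esym_Suc_le[of I a k] assms(1,2) m(1) by (simp add: field_simps)
  then have "fact (?m - Suc k) / fact ?m * fact k * (real (Suc k) * esym a I (Suc k))
      \<le> fact (?m - Suc k) / fact ?m * fact k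
          * (sum a I / ?m * ((real ?m - real k) * esym a I k))"
    by (rule mult_left_mono) simp
  also have "\<dots> = sum a I / ?m * (fact (?m - k) / fact ?m * (fact k * esym a I k))"
    by (simp add: f ac_simps)
  also have "\<dots> \<le> sum a I / ?m * (sum a I / ?m) ^ k"
    using Suc s by (intro mult_left_mono) auto
  finally show ?case by (simp add: ac_simps)
qed

text \<open>Injective tuples are grouped by their image: each \<open>k\<close>-subset is the image
  of \<open>fact k\<close> of them, all with the same product.\<close>

lemma sum_inj_tuples_eq_esym:
  fixes b :: "'i \<Rightarrow> real"
  assumes "finite I"
  shows "(\<Sum>j \<in> {j \<in> {1..k} \<rightarrow>\<^sub>E I. inj_on j {1..k}}. \<Prod>l=1..k. b (j l)) = fact k * esym b I k"
proof -
  let ?X = "{j \<in> {1..k::nat} \<rightarrow>\<^sub>E I. inj_on j {1..k}}"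
  let ?P = "{S. S \<subseteq> I \<and> card S = k}"
  let ?h = "\<lambda>j. \<Prod>l=1..k. b (j l)"
  have finX: "finite ?X"
    using assms by (intro finite_subset[OF _ finite_PiE[of "{1..k}" "\<lambda>_. I"]]) auto
  have finP: "finite ?P"
    using assms by (auto intro: finite_subset[of _ "Pow I"])
  have "sum ?h ?X = (\<Sum>S\<in>?P. sum ?h {j \<in> ?X. j ` {1..k} = S})"
    by (rule sum.group[symmetric, OF finX finP]) (auto simp: card_image)
  also have "\<dots> = (\<Sum>S\<in>?P. fact k * prod b S)"
  proof (intro sum.cong refl)
    fix S assume S: "S \<in> ?P"
    then have finS: "finite S" using assms by (auto dest: finite_subset)
    \<comment> \<open>An injection from \<open>{1..k}\<close> into a set of size \<open>k\<close> is
      onto, so the fibre over \<open>S\<close> consists of all injections into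
      \<open>S\<close>.\<close>
    have eq: "{j \<in> ?X. j ` {1..k} = S} = {j \<in> {1..k} \<rightarrow>\<^sub>E S. inj_on j {1..k}}"
    proof (intro equalityI subsetI)
      fix j assume j: "j \<in> {j \<in> {1..k} \<rightarrow>\<^sub>E S. inj_on j {1..k}}"
      then have "j ` {1..k} = S"
        using S finS by (intro card_subset_eq) (auto simp: card_image)
      then show "j \<in> {j \<in> ?X. j ` {1..k} = S}" using j S by auto
    qed auto
    have "card {j \<in> ?X. j ` {1..k} = S} = fact k"
      unfolding eq using S finS
      by (subst card_inj_on_subset_funcset) (auto simp: fact_prod_rev)
    moreover have "?h j = prod b S" if "j \<in> {j \<in> ?X. j ` {1..k} = S}" for j
      using that by (auto simp: prod.reindex)
    ultimately show "sum ?h {j \<in> ?X. j ` {1..k} = S} = fact k * prod b S"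
      by simp
  qed
  finally show ?thesis by (simp add: esym_def sum_distrib_left)
qed

text \<open>The scalar case of the claim: the sum over all tuples factors into a \<open>k\<close>-th
  power, and the sum over injective tuples is \<open>fact k\<close> times a symmetric
  polynomial.\<close>

lemma tuple_Maclaurin:
  fixes b :: "nat \<Rightarrow> real"
  assumes "\<And>i. i \<in> {1..n} \<Longrightarrow> 0 \<le> b i" "k \<le> n"
  shows "fact (n - k) / fact n *
      (\<Sum>j \<in> {j \<in> {1..k} \<rightarrow>\<^sub>E {1..n}. inj_on j {1..k}}. \<Prod>l=1..k. b (j l))
    \<le> 1 / real n ^ k * (\<Sum>j \<in> {1..k} \<rightarrow>\<^sub>E {1..n}. \<Prod>l=1..k. b (j l))"
proof -
  have "(\<Sum>j \<in> {1..k} \<rightarrow>\<^sub>E {1..n}. \<Prod>l=1..k. b (j l)) = sum b {1..n} ^ k"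
    using prod_sum_PiE[of "{1..k}" "\<lambda>_. {1..n}" "\<lambda>_. b"] by simp
  then show ?thesis
    using esym_Maclaurin[of "{1..n}" b k] assms sum_inj_tuples_eq_esym[of "{1..n}" b k]
    by (simp add: power_divide)
qed

section \<open>Common eigenvectors\<close>

text \<open>The form \<open>x \<bullet> T x\<close> attains its maximum on the compact unit sphere
  of \<open>V\<close>, and a maximiser is an eigenvector. The final bound records that
  \<open>c\<close> is the top eigenvalue on \<open>V\<close>, which later controls an operator
  norm.\<close>

lemma Rayleigh_eigenvector:
  fixes T :: "'a::euclidean_space \<Rightarrow> 'a"
  assumes V: "subspace V" "V \<noteq> {0}" and T: "linear T" "\<And>x. x \<in> V \<Longrightarrow> T x \<in> V"
    and sym: "\<And>x y. T x \<bullet> y = x \<bullet> T y"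
  obtains v c where "v \<in> V" "v \<noteq> 0" "T v = c *\<^sub>R v"
    "\<And>x. x \<in> V \<Longrightarrow> x \<bullet> T x \<le> c * (norm x)\<^sup>2"
proof -
  have "0 \<in> V" using V(1) by (rule subspace_0)
  then obtain w where w: "w \<in> V" "w \<noteq> 0" using V(2) by blast
  have "w /\<^sub>R norm w \<in> V \<inter> sphere 0 1"
    using w V(1) by (auto simp: subspace_scale)
  then have ne: "V \<inter> sphere 0 1 \<noteq> {}" by blast
  have comp: "compact (V \<inter> sphere 0 1)"
    using V(1) by (simp add: closed_Int_compact closed_subspace)
  have cont: "continuous_on (V \<inter> sphere 0 1) (\<lambda>x. x \<bullet> T x)"
    using T(1) by (intro continuous_intros linear_continuous_on linear_linear[THEN iffD1])
      (simp add: linear_conv_bounded_linear[symmetric])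
  obtain v where v: "v \<in> V" "norm v = 1"
    and max: "\<And>x. x \<in> V \<inter> sphere 0 1 \<Longrightarrow> x \<bullet> T x \<le> v \<bullet> T v"
    using continuous_attains_sup[OF comp ne cont] by auto
  define c where "c = v \<bullet> T v"
  have form: "x \<bullet> T x \<le> c * (norm x)\<^sup>2" if "x \<in> V" for x
  proof (cases "x = 0")
    case False
    have "x /\<^sub>R norm x \<in> V \<inter> sphere 0 1"
      using that False V(1) by (auto simp: subspace_scale)
    from max[OF this] show ?thesis
      using False by (simp add: linear_scale[OF T(1)] c_def power2_eq_square field_simps)
  qed (simp add: linear_0[OF T(1)])
  \<comment> \<open>The nonnegative form \<open>c |x|\<^sup>2 - x \<bullet> T x\<close> vanishes at \<open>v\<close>, so its first variation there
    in the direction \<open>u\<close> vanishes.\<close>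
  define u where "u = c *\<^sub>R v - T v"
  have uV: "u \<in> V" unfolding u_def using v T(2) V(1) by (simp add: subspace_diff subspace_scale)
  define q where "q = c * (norm u)\<^sup>2 - u \<bullet> T u"
  \<comment> \<open>The form is expanded at \<open>v + t *\<^sub>R u\<close>: the constant term
    vanishes by the definition of \<open>c\<close>, and the choice of \<open>u\<close> makes the
    linear coefficient \<open>2 * (u \<bullet> u)\<close>.\<close>
  have ineq: "0 \<le> 2 * t * (u \<bullet> u) + t\<^sup>2 * q" for t
  proof -
    have "v + t *\<^sub>R u \<in> V" using v uV V(1) by (simp add: subspace_add subspace_scale)
    from form[OF this]
    have "(v + t *\<^sub>R u) \<bullet> T (v + t *\<^sub>R u) \<le> c * ((v + t *\<^sub>R u) \<bullet> (v + t *\<^sub>R u))"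
      by (simp add: power2_norm_eq_inner)
    moreover have "v \<bullet> T u = u \<bullet> T v" using sym[of v u] by (simp add: inner_commute)
    then have "c * ((v + t *\<^sub>R u) \<bullet> (v + t *\<^sub>R u)) - (v + t *\<^sub>R u) \<bullet> T (v + t *\<^sub>R u)
        = (c * (v \<bullet> v) - v \<bullet> T v) + 2 * t * (c * (u \<bullet> v) - u \<bullet> T v)
          + t\<^sup>2 * (c * (u \<bullet> u) - u \<bullet> T u)"
      by (simp add: linear_add[OF T(1)] linear_scale[OF T(1)] inner_add_left inner_add_right
          inner_commute[of v u] algebra_simps power2_eq_square)
    moreover have "c * (v \<bullet> v) - v \<bullet> T v = 0"
      using v by (simp add: c_def power2_norm_eq_inner[symmetric])
    moreover have "c * (u \<bullet> v) - u \<bullet> T v = u \<bullet> (c *\<^sub>R v - T v)"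
      by (simp add: inner_diff_right)
    ultimately show ?thesis
      by (simp add: q_def power2_norm_eq_inner u_def[symmetric])
  qed
  have "u \<bullet> u = 0"
  proof (rule ccontr)
    assume "u \<bullet> u \<noteq> 0"
    then have pos: "0 < u \<bullet> u" by simp
    \<comment> \<open>A negative \<open>t\<close> so small that \<open>\<bar>t * q\<bar>\<close>
      stays below \<open>u \<bullet> u\<close>, hence the linear term wins; the \<open>+ 1\<close>
      keeps the denominator positive when \<open>q = 0\<close>.\<close>
    define t where "t = - (u \<bullet> u) / (\<bar>q\<bar> + 1)"
    have t: "t < 0" and tq: "t * (\<bar>q\<bar> + 1) = - (u \<bullet> u)"
      using pos by (auto simp: t_def divide_less_0_iff)
    have "- t * q \<le> - t * (\<bar>q\<bar> + 1)" using t by (intro mult_left_mono) auto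
    then have "- (u \<bullet> u) \<le> t * q" using tq by simp
    then have "0 < 2 * (u \<bullet> u) + t * q" using pos by linarith
    then have "t * (2 * (u \<bullet> u) + t * q) < 0" using t by (simp add: mult_less_0_iff)
    then show False using ineq[of t] by (simp add: algebra_simps power2_eq_square)
  qed
  then have "T v = c *\<^sub>R v" by (simp add: u_def)
  moreover have "v \<noteq> 0" using v by auto
  ultimately show ?thesis using that v(1) form by blast
qed

text \<open>An eigenspace of one operator inside \<open>V\<close> is nonzero and, by commutation,
  invariant under the others, so the induction continues inside it. This is why \<open>V\<close> is
  a general invariant subspace.\<close>

lemma common_eigenvector:
  fixes T :: "'i \<Rightarrow> 'a::euclidean_space \<Rightarrow> 'a"
  assumes "finite I" "subspace V" "V \<noteq> {0}"
    and "\<And>i. i \<in> I \<Longrightarrow> linear (T i)" "\<And>i x. i \<in> I \<Longrightarrow> x \<in> V \<Longrightarrow> T i x \<in> V"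
    and "\<And>i x y. i \<in> I \<Longrightarrow> T i x \<bullet> y = x \<bullet> T i y"
    and "\<And>i j x. i \<in> I \<Longrightarrow> j \<in> I \<Longrightarrow> T i (T j x) = T j (T i x)"
  shows "\<exists>v\<in>V. v \<noteq> 0 \<and> (\<forall>i\<in>I. \<exists>c. T i v = c *\<^sub>R v)"
  using assms
proof (induction I arbitrary: V rule: finite_induct)
  case empty
  then show ?case using subspace_0[of V] by auto
next
  case (insert i I)
  obtain w c where w: "w \<in> V" "w \<noteq> 0" "T i w = c *\<^sub>R w"
    using Rayleigh_eigenvector[of V "T i"] insert.prems by (metis insertI1)
  let ?V = "{x \<in> V. T i x = c *\<^sub>R x}"
  have lin: "linear (T j)" if "j \<in> insert i I" for j using insert.prems that by blast
  have "subspace ?V"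
    using insert.prems(1) lin[of i]
    by (auto simp: subspace_def linear_0 linear_add linear_scale scaleR_add_right mult.commute)
  moreover have "?V \<noteq> {0}" using w by auto
  moreover have "T j x \<in> ?V" if "j \<in> I" "x \<in> ?V" for j x
    using that insert.prems(4)[of j x] insert.prems(6)[of i j x] lin[of j]
    by (auto simp: linear_scale)
  ultimately have "\<exists>v\<in>?V. v \<noteq> 0 \<and> (\<forall>i\<in>I. \<exists>c. T i v = c *\<^sub>R v)"
    using insert.prems by (intro insert.IH) auto
  then show ?case by auto
qed

text \<open>The common eigenvector is sought in the top eigenspace of \<open>adjoint f \<circ> f\<close>, which is
  invariant under every \<open>T i\<close>.\<close>

lemma common_eigenvector_attaining_onorm:
  fixes T :: "'i \<Rightarrow> 'a::euclidean_space \<Rightarrow> 'a"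
  assumes "finite I" "linear f"
    and T: "\<And>i. i \<in> I \<Longrightarrow> linear (T i)" "\<And>i x y. i \<in> I \<Longrightarrow> T i x \<bullet> y = x \<bullet> T i y"
    and comm: "\<And>i j x. i \<in> I \<Longrightarrow> j \<in> I \<Longrightarrow> T i (T j x) = T j (T i x)"
    and comm_f: "\<And>i x. i \<in> I \<Longrightarrow> T i (f x) = f (T i x)"
  obtains v a where "v \<noteq> 0" "\<And>i. i \<in> I \<Longrightarrow> T i v = a i *\<^sub>R v" "onorm f * norm v \<le> norm (f v)"
proof -
  \<comment> \<open>Since \<open>x \<bullet> g x\<close> is the squared norm of \<open>f x\<close>,
    the top eigenvalue \<open>c\<close> of the symmetric map \<open>g\<close> bounds
    \<open>onorm f\<close> by \<open>sqrt c\<close>.\<close>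
  define g where "g x = adjoint f (f x)" for x
  have g: "linear g"
    using linear_compose[OF assms(2) adjoint_linear[OF assms(2)]] by (simp add: g_def[abs_def] comp_def)
  have g_inner: "x \<bullet> g y = f x \<bullet> f y" for x y
    using adjoint_works[OF assms(2)] by (simp add: g_def inner_commute)
  have g_sym: "g x \<bullet> y = x \<bullet> g y" for x y
    using g_inner[of y x] g_inner[of x y] by (simp add: inner_commute)
  have UNIV_ne: "(UNIV :: 'a set) \<noteq> {0}" using nonempty_Basis nonzero_Basis by blast
  obtain w c where w: "w \<noteq> 0" "g w = c *\<^sub>R w" and max: "\<And>x. x \<bullet> g x \<le> c * (norm x)\<^sup>2"
    using Rayleigh_eigenvector[OF subspace_UNIV UNIV_ne g _ g_sym] by auto
  have norm_f: "(norm (f x))\<^sup>2 \<le> c * (norm x)\<^sup>2" for x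
    using max[of x] by (simp add: g_inner power2_norm_eq_inner)
  have "0 \<le> c * (norm w)\<^sup>2" using norm_f[of w] by (rule order_trans[rotated]) simp
  then have c: "0 \<le> c" using w(1) by (simp add: zero_le_mult_iff)
  \<comment> \<open>Tested against \<open>y\<close>: symmetry moves \<open>T i\<close> onto
    \<open>y\<close>, \<open>g_inner\<close> replaces \<open>g\<close> by two copies of
    \<open>f\<close>, and \<open>T i\<close> passes through \<open>f\<close> on both sides.
    Commutation with \<open>adjoint f\<close> thus follows from that with \<open>f\<close>.\<close>
  have comm_g: "T i (g x) = g (T i x)" if "i \<in> I" for i x
  proof -
    have "y \<bullet> T i (g x) = y \<bullet> g (T i x)" for y
      using T(2)[OF that] comm_f[OF that] by (metis g_inner)
    then show ?thesis by (metis vector_eq_ldot)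
  qed
  \<comment> \<open>Every vector of this eigenspace is stretched by \<open>f\<close> by exactly
    \<open>sqrt c\<close>, so any common eigenvector found in it attains the norm.\<close>
  define V where "V = {x. g x = c *\<^sub>R x}"
  have "subspace V"
    using g by (auto simp: V_def subspace_def linear_0 linear_add linear_scale scaleR_add_right
        mult.commute)
  moreover have "V \<noteq> {0}" using w by (auto simp: V_def)
  moreover have "T i x \<in> V" if "i \<in> I" "x \<in> V" for i x
    using that comm_g[of i x, symmetric] T(1)[of i] by (simp add: V_def linear_scale)
  ultimately obtain v where v: "v \<in> V" "v \<noteq> 0" "\<forall>i\<in>I. \<exists>c. T i v = c *\<^sub>R v"
    using common_eigenvector[of I V T] assms by blast
  obtain a where a: "\<And>i. i \<in> I \<Longrightarrow> T i v = a i *\<^sub>R v"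
    using bchoice[OF v(3)] by blast
  have "(norm (f v))\<^sup>2 = c * (norm v)\<^sup>2"
    using g_inner[of v v] v(1) by (simp add: V_def power2_norm_eq_inner)
  then have "norm (f v) = sqrt c * norm v"
    using c by (metis norm_ge_zero power_mult_distrib real_sqrt_pow2 real_sqrt_ge_zero
        power2_eq_imp_eq mult_nonneg_nonneg)
  moreover have "onorm f \<le> sqrt c"
  proof (rule onorm_le)
    fix x
    show "norm (f x) \<le> sqrt c * norm x"
      using real_sqrt_le_mono[OF norm_f[of x]] by (simp add: real_sqrt_mult)
  qed
  ultimately have "onorm f * norm v \<le> norm (f v)" by (simp add: mult_right_mono)
  then show ?thesis using that v(2) a by blast
qed

section \<open>Matrix products and expectations\<close>

lemma mprod_eigenvector:
  fixes X :: "nat \<Rightarrow> real ^ 'd ^ 'd"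
  assumes "\<And>l. l \<in> {1..k} \<Longrightarrow> X l *v v = c l *\<^sub>R v"
  shows "mprod k X *v v = (\<Prod>l=1..k. c l) *\<^sub>R v"
  using assms
  by (induction k)
    (simp_all add: matrix_vector_mul_assoc[symmetric] matrix_vector_mult_scaleR mult.commute)

lemma mprod_commute:
  fixes X :: "nat \<Rightarrow> real ^ 'd ^ 'd"
  assumes "\<And>l. l \<in> {1..k} \<Longrightarrow> B ** X l = X l ** B"
  shows "B ** mprod k X = mprod k X ** B"
  using assms
proof (induction k)
  case (Suc k)
  have "B ** mprod (Suc k) X = (X (Suc k) ** B) ** mprod k X"
    using Suc.prems[of "Suc k"] by (simp add: matrix_mul_assoc)
  also have "\<dots> = mprod (Suc k) X ** B"
    using Suc by (simp add: matrix_mul_assoc[symmetric])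
  finally show ?case .
qed simp

lemma sum_matrix_vector_mult:
  fixes F :: "'j \<Rightarrow> real ^ 'm ^ 'n"
  shows "sum F J *v v = (\<Sum>j\<in>J. F j *v v)"
  by (induction J rule: infinite_finite_induct) (simp_all add: matrix_vector_mult_add_rdistrib)

lemma scaleR_sum_eigenvector:
  fixes F :: "'j \<Rightarrow> real ^ 'd ^ 'd"
  assumes "\<And>j. j \<in> J \<Longrightarrow> F j *v v = c j *\<^sub>R v"
  shows "(r *\<^sub>R sum F J) *v v = (r * sum c J) *\<^sub>R v"
  using assms
  by (simp add: scaleR_matrix_vector_assoc[symmetric] sum_matrix_vector_mult
      scaleR_sum_left[symmetric])

lemma scaleR_sum_matrix_vector_commute:
  fixes F :: "'j \<Rightarrow> real ^ 'd ^ 'd"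
  assumes "\<And>j. j \<in> J \<Longrightarrow> B ** F j = F j ** B"
  shows "B *v ((r *\<^sub>R sum F J) *v x) = (r *\<^sub>R sum F J) *v (B *v x)"
proof -
  have "B *v (\<Sum>j\<in>J. F j *v x) = (\<Sum>j\<in>J. F j *v (B *v x))"
    using assms
    by (simp add: linear_sum[OF matrix_vector_mul_linear] matrix_vector_mul_assoc)
  then show ?thesis
    by (simp add: scaleR_matrix_vector_assoc[symmetric] sum_matrix_vector_mult
        matrix_vector_mult_scaleR)
qed

text \<open>Abstracts the two properties shared by both products: \<open>F\<close> commutes with
  whatever commutes with its factors, and on a common eigenvector it acts by the product of
  \<open>h\<close> of the eigenvalues.\<close>

lemma opnorm_expect_wo_le_wr:
  fixes A :: "nat \<Rightarrow> real ^ 'd ^ 'd" and F :: "(nat \<Rightarrow> real ^ 'd ^ 'd) \<Rightarrow> real ^ 'd ^ 'd"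
  assumes psd: "\<And>i. i \<in> {1..n} \<Longrightarrow> psd (A i)"
    and comm: "\<And>i j. i \<in> {1..n} \<Longrightarrow> j \<in> {1..n} \<Longrightarrow> A i ** A j = A j ** A i"
    and "k \<le> n"
    and F_comm: "\<And>B X. (\<And>l. l \<in> {1..k} \<Longrightarrow> B ** X l = X l ** B) \<Longrightarrow> B ** F X = F X ** B"
    and F_eigen: "\<And>X v c. (\<And>l. l \<in> {1..k} \<Longrightarrow> X l *v v = c l *\<^sub>R v)
      \<Longrightarrow> F X *v v = (\<Prod>l=1..k. h (c l)) *\<^sub>R v"
    and h: "\<And>x::real. 0 \<le> x \<Longrightarrow> 0 \<le> h x"
  shows "opnorm (expect_wo n k A F) \<le> opnorm (expect_wr n k A F)"
proof -
  let ?W = "expect_wo n k A F" and ?R = "expect_wr n k A F"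
  let ?J = "{1..k} \<rightarrow>\<^sub>E {1..n}"
  let ?Jinj = "{j \<in> ?J. inj_on j {1..k}}"
  let ?p = "\<lambda>a j. \<Prod>l=1..k. h (a (j l))"
  have F_comm': "A i ** F (\<lambda>l\<in>{1..k}. A (j l)) = F (\<lambda>l\<in>{1..k}. A (j l)) ** A i"
    if "i \<in> {1..n}" "j \<in> ?J" for i j
    using that comm by (intro F_comm) (auto simp: PiE_iff)
  have sym: "(A i *v x) \<bullet> y = x \<bullet> (A i *v y)" if "i \<in> {1..n}" for i x y
    using psd[OF that] by (metis psd_def dot_lmul_matrix transpose_matrix_vector)
  obtain v a where v: "v \<noteq> 0" and a: "\<And>i. i \<in> {1..n} \<Longrightarrow> A i *v v = a i *\<^sub>R v"
    and att: "opnorm ?W * norm v \<le> norm (?W *v v)"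
    unfolding opnorm_def
  proof (rule common_eigenvector_attaining_onorm[of "{1..n}" "\<lambda>x. ?W *v x" "\<lambda>i x. A i *v x"])
    \<comment> \<open>Every summand of \<open>?W\<close> is \<open>F\<close> of matrices from the
      commuting family, so each \<open>A i\<close> commutes with the whole sum.\<close>
    show "A i *v (?W *v x) = ?W *v (A i *v x)" if "i \<in> {1..n}" for i x
      unfolding expect_wo_def using F_comm' that
      by (intro scaleR_sum_matrix_vector_commute) auto
    show "A i *v (A j *v x) = A j *v (A i *v x)" if "i \<in> {1..n}" "j \<in> {1..n}" for i j x
      using comm[OF that] by (simp add: matrix_vector_mul_assoc)
  qed (use sym in auto)
  have a_nonneg: "0 \<le> a i" if "i \<in> {1..n}" for i
  proof -
    have "0 \<le> v \<bullet> (A i *v v)" using psd[OF that] by (simp add: psd_def)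
    then show ?thesis
      using v a[OF that] by (simp add: power2_norm_eq_inner[symmetric] zero_le_mult_iff)
  qed
  have F_v: "F (\<lambda>l\<in>{1..k}. A (j l)) *v v = ?p a j *\<^sub>R v" if "j \<in> ?J" for j
    using that a by (intro F_eigen) (auto simp: PiE_iff)
  define p where "p = fact (n - k) / fact n * sum (?p a) ?Jinj"
  define q where "q = 1 / real n ^ k * sum (?p a) ?J"
  have W: "?W *v v = p *\<^sub>R v"
    unfolding expect_wo_def p_def using F_v by (intro scaleR_sum_eigenvector) auto
  have R: "?R *v v = q *\<^sub>R v"
    unfolding expect_wr_def q_def using F_v by (intro scaleR_sum_eigenvector) auto
  have "0 \<le> p"
    unfolding p_def using h a_nonneg
    by (intro mult_nonneg_nonneg sum_nonneg prod_nonneg) (auto simp: PiE_iff)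
  have "p \<le> q"
    unfolding p_def q_def using h a_nonneg \<open>k \<le> n\<close> by (intro tuple_Maclaurin) auto
  \<comment> \<open>Only \<open>?W\<close> has to attain its norm at \<open>v\<close>; for
    \<open>?R\<close> the value at \<open>v\<close> serves as a lower bound on the norm.\<close>
  have "opnorm ?W * norm v \<le> p * norm v"
    using att W \<open>0 \<le> p\<close> by simp
  also have "\<dots> \<le> norm (?R *v v)"
    using R \<open>0 \<le> p\<close> \<open>p \<le> q\<close> by (simp add: mult_right_mono)
  also have "\<dots> \<le> opnorm ?R * norm v"
    unfolding opnorm_def by (rule onorm) (simp add: linear_conv_bounded_linear[symmetric])
  finally show ?thesis using v by simp
qed

theorem mainTheorem2:
  fixes A :: "nat \<Rightarrow> real ^ 'd ^ 'd" and n k :: nat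
  assumes "\<And>i. i \<in> {1..n} \<Longrightarrow> psd (A i)"
    and "\<And>i j. i \<in> {1..n} \<Longrightarrow> j \<in> {1..n} \<Longrightarrow> A i ** A j = A j ** A i"
    and "1 \<le> k" and "k \<le> n"
  shows "opnorm (expect_wo n k A (\<lambda>X. mprod k (\<lambda>j. X j)))
           \<le> opnorm (expect_wr n k A (\<lambda>X. mprod k (\<lambda>j. X j)))
       \<and> opnorm (expect_wo n k A (\<lambda>X. mprod k (\<lambda>j. X (k - j + 1)) ** mprod k (\<lambda>j. X j)))
           \<le> opnorm (expect_wr n k A (\<lambda>X. mprod k (\<lambda>j. X (k - j + 1)) ** mprod k (\<lambda>j. X j)))"
proof
  show "opnorm (expect_wo n k A (\<lambda>X. mprod k (\<lambda>j. X j)))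
      \<le> opnorm (expect_wr n k A (\<lambda>X. mprod k (\<lambda>j. X j)))"
    using assms(1,2,4)
  proof (rule opnorm_expect_wo_le_wr[where h = "\<lambda>x. x"])
    show "B ** mprod k (\<lambda>j. X j) = mprod k (\<lambda>j. X j) ** B"
      if "\<And>l. l \<in> {1..k} \<Longrightarrow> B ** X l = X l ** B" for B :: "real ^ 'd ^ 'd" and X
      using that by (rule mprod_commute)
    show "mprod k (\<lambda>j. X j) *v v = (\<Prod>l=1..k. c l) *\<^sub>R v"
      if "\<And>l. l \<in> {1..k} \<Longrightarrow> X l *v v = c l *\<^sub>R v"
      for X :: "nat \<Rightarrow> real ^ 'd ^ 'd" and v c
      using that by (rule mprod_eigenvector)
  qed
  show "opnorm (expect_wo n k A (\<lambda>X. mprod k (\<lambda>j. X (k - j + 1)) ** mprod k (\<lambda>j. X j)))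
      \<le> opnorm (expect_wr n k A (\<lambda>X. mprod k (\<lambda>j. X (k - j + 1)) ** mprod k (\<lambda>j. X j)))"
    using assms(1,2,4)
  \<comment> \<open>Each factor occurs once in either half of the two-sided product, so its
    eigenvalue enters squared.\<close>
  proof (rule opnorm_expect_wo_le_wr[where h = "\<lambda>x. x\<^sup>2"])
    fix B :: "real ^ 'd ^ 'd" and X :: "nat \<Rightarrow> real ^ 'd ^ 'd"
    assume "\<And>l. l \<in> {1..k} \<Longrightarrow> B ** X l = X l ** B"
    then have rev: "B ** mprod k (\<lambda>j. X (k - j + 1)) = mprod k (\<lambda>j. X (k - j + 1)) ** B"
      and fwd: "B ** mprod k X = mprod k X ** B"
      by (auto intro!: mprod_commute)
    show "B ** (mprod k (\<lambda>j. X (k - j + 1)) ** mprod k (\<lambda>j. X j))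
        = mprod k (\<lambda>j. X (k - j + 1)) ** mprod k (\<lambda>j. X j) ** B"
      unfolding matrix_mul_assoc rev
      unfolding matrix_mul_assoc[symmetric] fwd ..
  next
    fix X :: "nat \<Rightarrow> real ^ 'd ^ 'd" and v c
    assume X: "\<And>l. l \<in> {1..k} \<Longrightarrow> X l *v v = c l *\<^sub>R v"
    have "mprod k (\<lambda>j. X (k - j + 1)) *v v = (\<Prod>l=1..k. c (k - l + 1)) *\<^sub>R v"
      by (rule mprod_eigenvector, rule X) auto
    \<comment> \<open>The reversal \<open>k - l + 1\<close> is an involution of
      \<open>{1..k}\<close>; the subtraction does not truncate there.\<close>
    also have "(\<Prod>l=1..k. c (k - l + 1)) = (\<Prod>l=1..k. c l)"
      by (rule prod.reindex_bij_witness[of _ "\<lambda>l. k - l + 1" "\<lambda>l. k - l + 1"]) auto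
    finally show "(mprod k (\<lambda>j. X (k - j + 1)) ** mprod k (\<lambda>j. X j)) *v v
        = (\<Prod>l=1..k. (c l)\<^sup>2) *\<^sub>R v"
      using mprod_eigenvector[OF X, of k]
      by (simp add: matrix_vector_mul_assoc[symmetric] matrix_vector_mult_scaleR
          prod.distrib power2_eq_square)
  qed auto
qed

end
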